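(* Let $O$ be a class and let $E$ be a class of ordered triples of elements of $O$. Let $S=(S^0,S^1,S^2,\ldots)$ and $T=(T^0,T^1,T^2,\ldots)$ be effaceable numerical $\delta$-functors on $(O,E)$ with $S^0=T^0$. Then $S=T$, i.e. $S^i=T^i$ for all $i\ge 0$.
   Context: A sequence $e_0,e_1,e_2,\ldots$ of real numbers is a numerical exact sequence if all $e_k\ge 0$ and $\sum_{j=0}^{k}(-1)^j e_{k-j}\ge 0$ for all $k\ge 0$. Given a class $O$ and a class $E$ of ordered triples of elements of $O$, a numerical $\delta$-functor on $(O,E)$ is a sequence $T=(T^0,T^1,T^2,\ldots)$ of functions from $O$ to the nonnegative reals such that for every $(A,B,C)\in E$ the sequence $T^0(A),T^0(B),T^0(C),T^1(A),T^1(B),T^1(C),T^2(A),\ldots$ is a numerical exact sequence. A function $F$ from $O$ to the nonnegative reals is effaceable if for every $A\in O$ and every $\epsilon>0$ there exists a triple $(A,B,C)\in E$ (with first entry $A$) such that $F(B)\le\epsilon$. A numerical $\delta$-functor $T$ is effaceable if $T^i$ is effaceable for all $i\ge 1$. *)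

theory Defs
  imports Complex_Main "HOL-Library.FuncSet"
begin

text \<open>
  A class of objects is a set \<open>Ob\<close> over an arbitrary type. A function from \<open>Ob\<close> to the
  nonnegative reals is a HOL function in \<open>Ob \<rightarrow> {0..}\<close>; its values outside \<open>Ob\<close> carry no
  meaning, so two such functions are equal if they agree on \<open>Ob\<close>.
\<close>

definition numerical_exact_sequence :: "(nat \<Rightarrow> real) \<Rightarrow> bool" where
  "numerical_exact_sequence e \<longleftrightarrow>
     (\<forall>k. e k \<ge> 0) \<and> (\<forall>k. (\<Sum>j=0..k. (-1) ^ j * e (k - j)) \<ge> 0)"

text \<open>The sequence \<open>T 0 A, T 0 B, T 0 C, T 1 A, T 1 B, T 1 C, T 2 A, \<dots>\<close>\<close>

definition long_sequence :: "(nat \<Rightarrow> 'a \<Rightarrow> real) \<Rightarrow> 'a \<Rightarrow> 'a \<Rightarrow> 'a \<Rightarrow> nat \<Rightarrow> real" where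
  "long_sequence T A B C n = T (n div 3) ([A, B, C] ! (n mod 3))"

definition numerical_delta_functor ::
  "'a set \<Rightarrow> ('a \<times> 'a \<times> 'a) set \<Rightarrow> (nat \<Rightarrow> 'a \<Rightarrow> real) \<Rightarrow> bool" where
  "numerical_delta_functor Ob E T \<longleftrightarrow>
     (\<forall>i. T i \<in> Ob \<rightarrow> {0..}) \<and>
     (\<forall>(A, B, C) \<in> E. numerical_exact_sequence (long_sequence T A B C))"

definition effaceable_fun ::
  "'a set \<Rightarrow> ('a \<times> 'a \<times> 'a) set \<Rightarrow> ('a \<Rightarrow> real) \<Rightarrow> bool" where
  "effaceable_fun Ob E F \<longleftrightarrow>
     (\<forall>A\<in>Ob. \<forall>\<epsilon>>0. \<exists>B C. (A, B, C) \<in> E \<and> F B \<le> \<epsilon>)"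

definition effaceable ::
  "'a set \<Rightarrow> ('a \<times> 'a \<times> 'a) set \<Rightarrow> (nat \<Rightarrow> 'a \<Rightarrow> real) \<Rightarrow> bool" where
  "effaceable Ob E T \<longleftrightarrow> (\<forall>i\<ge>1. effaceable_fun Ob E (T i))"

end

theory Submission
  imports Defs
begin

text \<open>
  The alternating sums of a numerical exact sequence play the role of the ranks of its maps, so
  consecutive ones add up to the term between them. Effacing \<open>T i\<close> by a triple \<open>(A, B, C)\<close> makes
  the rank of \<open>T i A \<rightarrow> T i B\<close> small, so \<open>T i A\<close> is nearly the rank of the connecting map
  \<open>T (i - 1) C \<rightarrow> T i A\<close>, which is determined by \<open>T j\<close> for \<open>j < i\<close> and is a lower bound
  for \<open>S i A\<close> as soon as \<open>S j = T j\<close> for all \<open>j < i\<close>. By symmetry equality follows by induction.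
\<close>

text \<open>For an honest exact sequence of vector spaces of dimensions \<open>e\<close>, this is
  the rank of the map from term \<open>k\<close> to term \<open>Suc k\<close>.\<close>

definition alt_sum :: "(nat \<Rightarrow> real) \<Rightarrow> nat \<Rightarrow> real" where
  "alt_sum e k = (\<Sum>j=0..k. (-1) ^ j * e (k - j))"

lemma alt_sum_Suc: "alt_sum e (Suc k) = e (Suc k) - alt_sum e k"
proof -
  have "alt_sum e (Suc k) = e (Suc k) + (\<Sum>j=0..k. (-1) ^ Suc j * e (k - j))"
    unfolding alt_sum_def by (subst sum.atLeast0_atMost_Suc_shift) simp
  then show ?thesis
    by (simp add: alt_sum_def sum_negf)
qed

lemma alt_sum_cong: "(\<And>n. n \<le> k \<Longrightarrow> e n = f n) \<Longrightarrow> alt_sum e k = alt_sum f k"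
  unfolding alt_sum_def by (intro sum.cong) auto

lemma alt_sum_nonneg: "numerical_exact_sequence e \<Longrightarrow> 0 \<le> alt_sum e k"
  unfolding numerical_exact_sequence_def alt_sum_def by blast

text \<open>Nonnegativity of \<open>alt_sum e\<close> at \<open>Suc k\<close> and at
  \<open>Suc (Suc k)\<close>: the rank of the incoming map is at most its target, and that of the
  outgoing map at most the next term.\<close>

lemma numerical_exact_sequence_term_bounds:
  assumes "numerical_exact_sequence e"
  shows "alt_sum e k \<le> e (Suc k)" and "e (Suc k) \<le> alt_sum e k + e (Suc (Suc k))"
  using alt_sum_nonneg[OF assms, of "Suc k"] alt_sum_nonneg[OF assms, of "Suc (Suc k)"]
  by (simp_all add: alt_sum_Suc)

lemma long_sequence_eq:
  assumes "\<And>j. j \<le> i \<Longrightarrow> S j A = T j A" "\<And>j. j \<le> i \<Longrightarrow> S j B = T j B"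
    and "\<And>j. j \<le> i \<Longrightarrow> S j C = T j C" and "n \<le> 3 * i + 2"
  shows "long_sequence S A B C n = long_sequence T A B C n"
proof -
  have "n mod 3 = 0 \<or> n mod 3 = 1 \<or> n mod 3 = 2" and "n div 3 \<le> i"
    using assms(4) by auto
  then show ?thesis
    using assms(1-3) unfolding long_sequence_def by auto
qed

lemma effaceable_delta_functor_le:
  assumes "E \<subseteq> Ob \<times> Ob \<times> Ob"
    and S: "numerical_delta_functor Ob E S"
    and T: "numerical_delta_functor Ob E T" and eff: "effaceable_fun Ob E (T (Suc i))"
    and eq: "\<And>j A. j \<le> i \<Longrightarrow> A \<in> Ob \<Longrightarrow> S j A = T j A" and "A \<in> Ob"
  shows "T (Suc i) A \<le> S (Suc i) A"
proof (rule field_le_epsilon)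
  fix \<epsilon> :: real assume "0 < \<epsilon>"
  then obtain B C where ABC: "(A, B, C) \<in> E" and B: "T (Suc i) B \<le> \<epsilon>"
    using eff \<open>A \<in> Ob\<close> unfolding effaceable_fun_def by blast
  let ?s = "long_sequence S A B C" and ?t = "long_sequence T A B C"
  have exact: "numerical_exact_sequence ?s" "numerical_exact_sequence ?t"
    using S T ABC unfolding numerical_delta_functor_def by auto
  \<comment> \<open>Position \<open>3 * i + 2\<close> holds \<open>U i C\<close>, the last term of
    degree \<open>i\<close>; the connecting map leads from there to
    \<open>U (Suc i) A\<close>.\<close>
  have terms: "long_sequence U A B C (Suc (3 * i + 2)) = U (Suc i) A"
    "long_sequence U A B C (Suc (Suc (3 * i + 2))) = U (Suc i) B" for U :: "nat \<Rightarrow> 'a \<Rightarrow> real"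
  proof -
    have "Suc (3 * i + 2) = 3 * Suc i" "Suc (Suc (3 * i + 2)) = 3 * Suc i + 1"
      by simp_all
    moreover have "(3 * Suc i) div 3 = Suc i" "(3 * Suc i) mod 3 = 0"
      "(3 * Suc i + 1) div 3 = Suc i" "(3 * Suc i + 1) mod 3 = 1"
      by presburger+
    ultimately show "long_sequence U A B C (Suc (3 * i + 2)) = U (Suc i) A"
      "long_sequence U A B C (Suc (Suc (3 * i + 2))) = U (Suc i) B"
      unfolding long_sequence_def by simp_all
  qed
  have "B \<in> Ob" "C \<in> Ob"
    using assms(1) ABC by auto
  then have "alt_sum ?s (3 * i + 2) = alt_sum ?t (3 * i + 2)"
    using eq \<open>A \<in> Ob\<close> by (intro alt_sum_cong long_sequence_eq) auto
  \<comment> \<open>The common alternating sum is at most \<open>S (Suc i) A\<close>, while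
    \<open>T (Suc i) A\<close> exceeds it by at most \<open>T (Suc i) B\<close>.\<close>
  then show "T (Suc i) A \<le> S (Suc i) A + \<epsilon>"
    using numerical_exact_sequence_term_bounds(1)[OF exact(1), of "3 * i + 2"]
      numerical_exact_sequence_term_bounds(2)[OF exact(2), of "3 * i + 2"] B
    unfolding terms by linarith
qed

theorem theorem2p7:
  fixes Ob :: "'a set"
    and E :: "('a \<times> 'a \<times> 'a) set"
    and S T :: "nat \<Rightarrow> 'a \<Rightarrow> real"
  assumes "E \<subseteq> Ob \<times> Ob \<times> Ob"
    and "numerical_delta_functor Ob E S" and "effaceable Ob E S"
    and "numerical_delta_functor Ob E T" and "effaceable Ob E T"
    and "\<forall>A\<in>Ob. S 0 A = T 0 A"
  shows "\<forall>i. \<forall>A\<in>Ob. S i A = T i A"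
proof
  fix i
  show "\<forall>A\<in>Ob. S i A = T i A"
  proof (induction i rule: less_induct)
    case (less i)
    show ?case
    proof (cases i)
      case 0
      then show ?thesis using assms(6) by simp
    next
      case (Suc k)
      \<comment> \<open>Strong induction, since the alternating sum involves all degrees up to
        \<open>k\<close>.\<close>
      have eq: "S j A = T j A" if "j \<le> k" "A \<in> Ob" for j A
        using less Suc that by simp
      have eff: "effaceable_fun Ob E (S (Suc k))" "effaceable_fun Ob E (T (Suc k))"
        using assms(3,5) unfolding effaceable_def by auto
      show ?thesis
        unfolding Suc
        using effaceable_delta_functor_le[OF assms(1,2,4) eff(2) eq]
          effaceable_delta_functor_le[OF assms(1,4,2) eff(1) eq[symmetric]]
        by (meson order_antisym)
    qed
  qed
qed

end
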